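(* Let $\alpha_t\equiv\alpha$ and $\beta_t\equiv\beta$ be constant with $0<\alpha<\beta$. A mixing control with $\pi_t\in(0,1)$ is non-optimal over any interval of time; that is, if $\pi$ is an optimal control, then there is no non-degenerate interval $I\subseteq[0,1]$ such that $\pi_t\in(0,1)$ for all $t\in I$.
   Context: Fix $\sigma>0$ and $\lambda>0$. Let $\Phi$ be the standard normal distribution function, and for $t\in[0,1]$ put $h(t)=2\Phi(\sigma(1-t)/2)-1$ and $g(t)=\int_0^t h(u)\,\mathrm{d}u$. Put $\kappa=1-\alpha/\beta\in(0,1)$. A control is a right-continuous function with left limits $\pi:[0,1]\to[0,1]$, $t\mapsto\pi_t$ ($\pi_t$ is the probability of sparing, i.e. threshold, disclosure at time $t$; $\pi_t=0$ is candid, $\pi_t=1$ is sparing). The corresponding state (valuation) $\gamma_t=\gamma^\pi_t$ is the solution of $\gamma_t'=-\lambda\pi_t h(t)\gamma_t$, $\gamma_0=1$. Write $\gamma^1_t=e^{-\lambda g(t)}$ for the state when $\pi\equiv1$. A control is optimal if it maximizes, over all controls, the objective $\int_0^1(1-\pi_t)\,\beta\,[\gamma^1_t-\kappa\gamma_t]\,\mathrm{d}t$. *)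

theory Defs
  imports "HOL-Probability.Probability"
begin

definition h :: "real \<Rightarrow> real \<Rightarrow> real" where
  "h \<sigma> t = 2 * cdf std_normal_distribution (\<sigma> * (1 - t) / 2) - 1"

definition g :: "real \<Rightarrow> real \<Rightarrow> real" where
  "g \<sigma> t = integral {0..t} (h \<sigma>)"

text \<open>Controls are total functions on the reals; only their values on the unit interval matter
  for the notions below.  At \<^term>\<open>1\<close> right-continuity, and at \<^term>\<open>0\<close> the left limit, are void.\<close>

definition control :: "(real \<Rightarrow> real) \<Rightarrow> bool" where
  "control p \<longleftrightarrow>
     p ` {0..1} \<subseteq> {0..1} \<and>
     (\<forall>t\<in>{0..<1}. continuous (at_right t) p) \<and>
     (\<forall>t\<in>{0<..1}. \<exists>l. (p \<longlongrightarrow> l) (at_left t))"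

text \<open>A control may jump, and at a jump the state equation
  \<open>\<gamma>' = - \<lambda> \<pi> h \<gamma>\<close> cannot hold with a two-sided derivative.  As the control is right-continuous,
  a solution is a continuous function satisfying the equation with the right derivative at every
  time; this is the same as solving the integrated equation.  The two lemmas at the end of this
  theory show that the solution exists and is unique on the unit interval.\<close>

definition is_valuation :: "real \<Rightarrow> real \<Rightarrow> (real \<Rightarrow> real) \<Rightarrow> (real \<Rightarrow> real) \<Rightarrow> bool" where
  "is_valuation \<sigma> lam p \<gamma> \<longleftrightarrow>
     continuous_on {0..1} \<gamma> \<and> \<gamma> 0 = 1 \<and>
     (\<forall>t\<in>{0..<1}. (\<gamma> has_real_derivative - lam * p t * h \<sigma> t * \<gamma> t) (at_right t))"

definition valuation :: "real \<Rightarrow> real \<Rightarrow> (real \<Rightarrow> real) \<Rightarrow> real \<Rightarrow> real" where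
  "valuation \<sigma> lam p t = (THE y. \<exists>\<gamma>. is_valuation \<sigma> lam p \<gamma> \<and> \<gamma> t = y)"

definition sparing_valuation :: "real \<Rightarrow> real \<Rightarrow> real \<Rightarrow> real" where
  "sparing_valuation \<sigma> lam t = exp (- lam * g \<sigma> t)"

definition objective :: "real \<Rightarrow> real \<Rightarrow> real \<Rightarrow> real \<Rightarrow> (real \<Rightarrow> real) \<Rightarrow> real" where
  "objective \<sigma> lam \<alpha> \<beta> p =
     (let \<kappa> = 1 - \<alpha> / \<beta> in
      integral {0..1}
        (\<lambda>t. (1 - p t) * \<beta> * (sparing_valuation \<sigma> lam t - \<kappa> * valuation \<sigma> lam p t)))"

definition optimal_control :: "real \<Rightarrow> real \<Rightarrow> real \<Rightarrow> real \<Rightarrow> (real \<Rightarrow> real) \<Rightarrow> bool" where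
  "optimal_control \<sigma> lam \<alpha> \<beta> p \<longleftrightarrow>
     control p \<and>
     (\<forall>q. control q \<longrightarrow> objective \<sigma> lam \<alpha> \<beta> q \<le> objective \<sigma> lam \<alpha> \<beta> p)"

lemma continuous_on_h: "continuous_on A (h \<sigma>)"
proof -
  interpret real_distribution std_normal_distribution
    by (rule real_dist_normal_dist)
  have "measure std_normal_distribution {x} = 0" for x
  proof -
    have "emeasure std_normal_distribution {x} = 0"
    proof (subst emeasure_density)
      have "(\<integral>\<^sup>+y. ennreal (std_normal_density y) * indicator {x} y \<partial>lborel) = (\<integral>\<^sup>+y. 0 \<partial>(lborel :: real measure))"
        by (rule nn_integral_cong_AE, rule AE_mp[OF AE_lborel_singleton[of x]], rule AE_I2) simp
      thus "(\<integral>\<^sup>+y. ennreal (std_normal_density y) * indicator {x} y \<partial>lborel) = 0" by simp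
    qed auto
    thus ?thesis by (simp add: measure_def)
  qed
  hence "continuous_on UNIV (cdf std_normal_distribution)"
    by (simp add: continuous_on_eq_continuous_at isCont_cdf)
  from continuous_on_compose2[OF this, of A "\<lambda>t. \<sigma> * (1 - t) / 2"]
  have "continuous_on A (\<lambda>t. cdf std_normal_distribution (\<sigma> * (1 - t) / 2))"
    by (simp add: continuous_intros)
  thus ?thesis unfolding h_def [abs_def]
    by (intro continuous_on_diff continuous_on_mult continuous_on_const)
qed

lemma control_measurable:
  assumes "control p"
  shows "(\<lambda>x. if x \<in> {0..1} then p x else 0) \<in> borel_measurable borel"
proof -
  define q where "q x = p (max 0 (min 1 x))" for x
  define f where "f n x = q ((of_int \<lfloor>real (Suc n) * x\<rfloor> + 1) / real (Suc n))" for n x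
  have f: "f n \<in> borel_measurable borel" for n
  proof -
    have "(\<lambda>x::real. \<lfloor>real (Suc n) * x\<rfloor>) \<in> borel \<rightarrow>\<^sub>M count_space UNIV" by measurable
    hence "(\<lambda>x. (\<lambda>k. q ((of_int k + 1) / real (Suc n))) \<lfloor>real (Suc n) * x\<rfloor>) \<in> borel_measurable borel"
      by (rule measurable_compose) simp
    thus ?thesis by (simp only: f_def [abs_def])
  qed
  have lim: "(\<lambda>n. f n x) \<longlonglongrightarrow> q x" if x: "x \<in> {0..<1}" for x
  proof -
    define y where "y n = (of_int \<lfloor>real (Suc n) * x\<rfloor> + 1) / real (Suc n)" for n
    have gt: "y n > x" for n
      unfolding y_def by (simp add: field_simps) linarith
    have le: "y n \<le> x + 1 / real (Suc n)" for n
    proof -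
      have "y n \<le> (real (Suc n) * x + 1) / real (Suc n)"
        unfolding y_def by (intro divide_right_mono add_right_mono of_int_floor_le) simp
      also have "\<dots> = x + 1 / real (Suc n)" by (simp add: add_divide_distrib del: of_nat_Suc)
      finally show ?thesis .
    qed
    have y: "y \<longlonglongrightarrow> x"
    proof (rule tendsto_sandwich)
      show "\<forall>\<^sub>F n in sequentially. x \<le> y n"
        using gt by (intro always_eventually allI less_imp_le)
      show "\<forall>\<^sub>F n in sequentially. y n \<le> x + 1 / real (Suc n)"
        using le by (intro always_eventually allI)
      show "(\<lambda>n. x + 1 / real (Suc n)) \<longlonglongrightarrow> x"
        using tendsto_add[OF tendsto_const LIMSEQ_inverse_real_of_nat, of x]
        by (simp add: inverse_eq_divide)
    qed auto
    have lt1: "\<forall>\<^sub>F n in sequentially. y n < 1"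
      using order_tendstoD(2)[OF y] x by auto
    have "filterlim y (at_right x) sequentially"
      using y gt by (auto simp: filterlim_at intro!: always_eventually)
    moreover have "(p \<longlongrightarrow> p x) (at_right x)"
      using assms x by (auto simp: control_def continuous_within)
    ultimately have "(\<lambda>n. p (y n)) \<longlonglongrightarrow> p x"
      by (rule filterlim_compose[rotated])
    moreover have "\<forall>\<^sub>F n in sequentially. p (y n) = f n x"
      using lt1
    proof eventually_elim
      case (elim n)
      have "max 0 (min 1 (y n)) = y n" using gt[of n] x elim by auto
      thus ?case by (simp only: f_def q_def flip: y_def)
    qed
    ultimately show ?thesis
      using x by (auto simp: q_def dest: Lim_transform_eventually)
  qed
  have "(\<lambda>x. if x \<in> {0..<1} then q x else 0) \<in> borel_measurable borel"
  proof (rule borel_measurable_LIMSEQ_real)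
    show "(\<lambda>n. if x \<in> {0..<1} then f n x else 0) \<longlonglongrightarrow> (if x \<in> {0..<1} then q x else 0)" for x
      using lim by auto
    show "(\<lambda>x. if x \<in> {0..<1} then f n x else 0) \<in> borel_measurable borel" for n
      using f[of n] by measurable
  qed
  hence "(\<lambda>x. if x = 1 then p 1 else if x \<in> {0..<1} then q x else 0) \<in> borel_measurable borel"
    by measurable
  moreover have "(\<lambda>x. if x = 1 then p 1 else if x \<in> {0..<1} then q x else 0) =
      (\<lambda>x. if x \<in> {0..1} then p x else 0)"
    by (auto simp: fun_eq_iff q_def)
  ultimately show ?thesis by simp
qed

lemma control_mult_integrable:
  assumes "control p" "continuous_on {0..1} k"
  shows "(\<lambda>t. p t * k t) integrable_on {0..1}"
proof -
  have "set_integrable lborel {0..1} (\<lambda>t. k t)"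
    using assms(2) by (rule borel_integrable_atLeastAtMost')
  hence "integrable lborel (\<lambda>t. indicator {0..1} t * k t)"
    by (simp add: set_integrable_def)
  moreover have "(\<lambda>t. (if t \<in> {0..1} then p t else 0) * (indicator {0..1} t * k t))
      \<in> borel_measurable lborel"
    using control_measurable[OF assms(1)] borel_measurable_integrable[OF calculation]
    by measurable
  ultimately have "integrable lborel
      (\<lambda>t. (if t \<in> {0..1} then p t else 0) * (indicator {0..1} t * k t))"
  proof (rule Bochner_Integration.integrable_bound)
    have "\<bar>p t\<bar> \<le> 1" if "t \<in> {0..1}" for t
      using assms(1) that by (auto simp: control_def image_subset_iff)
    thus "AE t in lborel. norm ((if t \<in> {0..1} then p t else 0) * (indicator {0..1} t * k t))
        \<le> norm (indicator {0..1} t * k t)"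
      by (intro AE_I2) (auto simp: abs_mult indicator_def intro: mult_left_le_one_le)
  qed
  hence "set_integrable lborel {0..1} (\<lambda>t. p t * k t)"
    unfolding set_integrable_def
    by (rule Bochner_Integration.integrable_cong[THEN iffD1, rotated -1])
       (auto simp: indicator_def)
  thus ?thesis
    using set_borel_integral_eq_integral(1) by blast
qed

lemma right_derivative_zero_imp_const:
  fixes f :: "real \<Rightarrow> real"
  assumes "a \<le> b" and cont: "continuous_on {a..b} f"
    and der: "\<And>t. t \<in> {a..<b} \<Longrightarrow> (f has_real_derivative 0) (at_right t)"
  shows "f b = f a"
proof -
  have le: "\<bar>f b - f a\<bar> \<le> e * (b - a)" if "e > 0" for e
  proof -
    define T where "T = {a..b} \<inter> (\<lambda>t. \<bar>f t - f a\<bar> - e * (t - a)) -` {..0}"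
    have "closed T" unfolding T_def
      by (intro continuous_closed_preimage continuous_intros cont closed_real_atLeastAtMost closed_atMost)
    moreover have "bounded T" by (rule bounded_subset[of "{a..b}"]) (auto simp: T_def)
    ultimately have "compact T" by (simp add: compact_eq_bounded_closed)
    moreover have "T \<noteq> {}" using \<open>a \<le> b\<close> by (auto simp: T_def)
    ultimately have "\<exists>c\<in>T. \<forall>t\<in>T. t \<le> c" by (rule compact_attains_sup)
    then obtain c where c: "c \<in> T" "\<And>t. t \<in> T \<Longrightarrow> t \<le> c" by metis
    have "c = b"
    proof (rule ccontr)
      assume "c \<noteq> b"
      hence cb: "a \<le> c" "c < b" using c(1) by (auto simp: T_def)
      hence "((\<lambda>t. (f t - f c) / (t - c)) \<longlongrightarrow> 0) (at_right c)"
        using der[of c] by (simp add: has_field_derivative_iff)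
      from tendstoD[OF this \<open>e > 0\<close>]
      have "\<forall>\<^sub>F t in at_right c. \<bar>(f t - f c) / (t - c)\<bar> < e" by (simp add: dist_real_def)
      moreover have "\<forall>\<^sub>F t in at_right c. t \<in> {c<..<b}"
        using cb(2) by (rule eventually_at_right_real)
      ultimately have "\<forall>\<^sub>F t in at_right c. \<bar>(f t - f c) / (t - c)\<bar> < e \<and> t \<in> {c<..<b}"
        by (rule eventually_conj)
      hence "\<exists>t. \<bar>(f t - f c) / (t - c)\<bar> < e \<and> t \<in> {c<..<b}"
        by (rule eventually_happens'[rotated]) simp
      then obtain t where t: "\<bar>(f t - f c) / (t - c)\<bar> < e" "t \<in> {c<..<b}" by metis
      have "\<bar>f t - f c\<bar> \<le> e * (t - c)" using t by (simp add: field_simps)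
      moreover have "\<bar>f c - f a\<bar> \<le> e * (c - a)" using c(1) by (simp add: T_def)
      ultimately have "\<bar>f t - f a\<bar> \<le> e * (t - a)" by (simp add: algebra_simps)
      hence "t \<in> T" using t(2) cb by (simp add: T_def)
      thus False using c(2) t(2) by fastforce
    qed
    thus ?thesis using c(1) by (simp add: T_def)
  qed
  show ?thesis
  proof (rule ccontr)
    assume ne: "f b \<noteq> f a"
    hence "a < b" using \<open>a \<le> b\<close> by (cases "a = b") auto
    have "\<bar>f b - f a\<bar> \<le> \<bar>f b - f a\<bar> / 2 / (b - a) * (b - a)"
      by (rule le) (use ne \<open>a < b\<close> in simp)
    also have "\<dots> = \<bar>f b - f a\<bar> / 2"
      using \<open>a < b\<close> by (intro nonzero_eq_divide_eq[THEN iffD1]) auto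
    finally show False using ne by simp
  qed
qed

lemma control_integral:
  assumes "control p" and k: "continuous_on {0..1} k"
  shows "continuous_on {0..1} (\<lambda>t. integral {0..t} (\<lambda>u. p u * k u))"
    and "t \<in> {0..<1} \<Longrightarrow>
      ((\<lambda>t. integral {0..t} (\<lambda>u. p u * k u)) has_real_derivative p t * k t) (at_right t)"
proof -
  note int = control_mult_integrable[OF assms]
  show "continuous_on {0..1} (\<lambda>t. integral {0..t} (\<lambda>u. p u * k u))"
    using int by (rule indefinite_integral_continuous_1)
  assume t: "t \<in> {0..<1}"
  have eq: "at t within {t..1} = at_right t"
    using t at_within_Icc_at_right[of t 1] by simp
  have int': "(\<lambda>u. p u * k u) integrable_on {t..1}"
    using integrable_subinterval_real[OF int, of t 1] t by auto
  have "continuous (at t within {t..1}) p"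
    using assms(1) t by (simp add: eq control_def)
  moreover have "continuous (at t within {t..1}) k"
    using continuous_within_subset[of t "{0..1}" k "{t..1}"] k t
    by (simp add: continuous_on_eq_continuous_within)
  ultimately have "continuous (at t within {t..1} - {}) (\<lambda>u. p u * k u)"
    by (auto intro: continuous_mult)
  from integral_has_vector_derivative_continuous_at[OF int' _ _ this] t
  have "((\<lambda>u. integral {t..u} (\<lambda>u. p u * k u)) has_real_derivative p t * k t) (at t within {t..1})"
    by (simp add: has_real_derivative_iff_has_vector_derivative)
  hence "((\<lambda>s. integral {0..t} (\<lambda>u. p u * k u) + integral {t..s} (\<lambda>u. p u * k u))
      has_real_derivative p t * k t) (at t within {t..1})"
    by (auto intro!: derivative_eq_intros)
  hence "((\<lambda>t. integral {0..t} (\<lambda>u. p u * k u)) has_real_derivative p t * k t) (at t within {t..1})"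
  proof (rule has_field_derivative_transform_within[OF _ zero_less_one])
    show "t \<in> {t..1}" using t by simp
    fix s assume s: "s \<in> {t..1}"
    have "(\<lambda>u. p u * k u) integrable_on {0..s}"
      using integrable_subinterval_real[OF int, of 0 s] s t by auto
    thus "integral {0..t} (\<lambda>u. p u * k u) + integral {t..s} (\<lambda>u. p u * k u) =
        integral {0..s} (\<lambda>u. p u * k u)"
      using s t Henstock_Kurzweil_Integration.integral_combine[of 0 t s "\<lambda>u. p u * k u"] by simp
  qed
  thus "((\<lambda>t. integral {0..t} (\<lambda>u. p u * k u)) has_real_derivative p t * k t) (at_right t)"
    by (simp add: eq)
qed

lemma is_valuation_exp:
  assumes "control p"
  shows "is_valuation \<sigma> lam p (\<lambda>t. exp (- lam * integral {0..t} (\<lambda>u. p u * h \<sigma> u)))"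
proof -
  note c = control_integral[OF assms continuous_on_h[of _ \<sigma>]]
  show ?thesis unfolding is_valuation_def
    by (intro conjI ballI continuous_intros c(1))
       (auto intro!: derivative_eq_intros c(2))
qed

lemma valuation_unique:
  assumes "control p" "is_valuation \<sigma> lam p \<gamma>" "t \<in> {0..1}"
  shows "\<gamma> t = exp (- lam * integral {0..t} (\<lambda>u. p u * h \<sigma> u))"
    and "valuation \<sigma> lam p t = \<gamma> t"
proof -
  note c = control_integral[OF assms(1) continuous_on_h[of _ \<sigma>]]
  have *: "\<delta> t = exp (- lam * integral {0..t} (\<lambda>u. p u * h \<sigma> u))"
    if v: "is_valuation \<sigma> lam p \<delta>" for \<delta>
  proof -
    have "\<delta> t * exp (lam * integral {0..t} (\<lambda>u. p u * h \<sigma> u)) =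
        \<delta> 0 * exp (lam * integral {0..0} (\<lambda>u. p u * h \<sigma> u))"
    proof (rule right_derivative_zero_imp_const
        [where f = "\<lambda>t. \<delta> t * exp (lam * integral {0..t} (\<lambda>u. p u * h \<sigma> u))"])
      show "0 \<le> t" using assms(3) by simp
      show "continuous_on {0..t} (\<lambda>t. \<delta> t * exp (lam * integral {0..t} (\<lambda>u. p u * h \<sigma> u)))"
        using v assms(3) unfolding is_valuation_def
        by (intro continuous_intros continuous_on_subset[OF c(1)])
           (auto intro: continuous_on_subset)
      fix s assume "s \<in> {0..<t}"
      hence s: "s \<in> {0..<1}" using assms(3) by auto
      hence d: "(\<delta> has_real_derivative - lam * p s * h \<sigma> s * \<delta> s) (at_right s)"
        using v by (auto simp: is_valuation_def)
      show "((\<lambda>t. \<delta> t * exp (lam * integral {0..t} (\<lambda>u. p u * h \<sigma> u)))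
          has_real_derivative 0) (at_right s)"
        by (auto intro!: derivative_eq_intros d c(2) s simp: algebra_simps)
    qed
    thus ?thesis using v by (simp add: is_valuation_def exp_minus field_simps)
  qed
  show "\<gamma> t = exp (- lam * integral {0..t} (\<lambda>u. p u * h \<sigma> u))"
    using assms(2) by (rule *)
  show "valuation \<sigma> lam p t = \<gamma> t"
    unfolding valuation_def using assms(2) * by (intro the_equality) (metis, metis)
qed

end

theory Submission
  imports Defs
begin

text \<open>Let \<open>w\<close> be a smooth function supported in \<open>[a, b]\<close> with \<open>b < 1\<close>.  Adding \<open>w' / (\<lambda> h)\<close> to the control
  \<open>\<pi>\<close> multiplies the valuation \<open>\<gamma>\<close> by \<open>exp (- w)\<close>, and integration by parts gives the exact increment
  \<open>- \<beta> \<integral> \<psi> (w \<gamma>\<^sup>1 + \<kappa> \<gamma> (exp (- w) - 1))\<close> of the objective, with \<open>\<psi> = 1 + h' / (\<lambda> h\<^sup>2)\<close>; its first-order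
  part is \<open>- \<beta> \<integral> \<psi> (\<gamma>\<^sup>1 - \<kappa> \<gamma>) w\<close>.  Where \<open>0 < \<pi> < 1\<close>, small \<open>w\<close> of either sign are admissible, so
  optimality forces \<open>\<psi> (\<gamma>\<^sup>1 - \<kappa> \<gamma>) = 0\<close>.  As \<open>\<psi>\<close> is strictly decreasing, it has at most one zero, so
  \<open>\<gamma>\<^sup>1 = \<kappa> \<gamma>\<close> on a subinterval.  Differentiating this identity gives \<open>\<pi> = 1\<close> there.\<close>

section \<open>Calculus of the normal distribution function and of \<open>h\<close>\<close>

lemma cdf_std_normal_diff:
  assumes "x < y"
  shows "cdf std_normal_distribution y - cdf std_normal_distribution x = integral {x..y} std_normal_density"
proof -
  interpret real_distribution std_normal_distribution by (rule real_dist_normal_dist)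
  have cont: "continuous_on {x..y} std_normal_density"
    unfolding normal_density_def by (intro continuous_intros) auto
  have int: "set_integrable lborel {x..y} std_normal_density"
    using cont by (rule borel_integrable_atLeastAtMost')
  have "measure std_normal_distribution {x<..y} = (LINT z|std_normal_distribution. indicator {x<..y} z)"
    by simp
  also have "\<dots> = (LINT z|lborel. std_normal_density z * indicator {x<..y} z)"
    by (rule integral_real_density) (auto intro: AE_I2)
  also have "\<dots> = (LINT z|lborel. indicator {x..y} z * std_normal_density z)"
  proof (rule integral_cong_AE)
    show "AE z in lborel. std_normal_density z * indicator {x<..y} z = indicator {x..y} z * std_normal_density z"
      using AE_lborel_singleton[of x] by eventually_elim (simp split: split_indicator)
  qed measurable
  also have "\<dots> = integral {x..y} std_normal_density"
    using set_borel_integral_eq_integral(2)[OF int] by (simp add: set_lebesgue_integral_def)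
  finally show ?thesis using cdf_diff_eq[OF assms] by simp
qed

lemma DERIV_cdf_std_normal [derivative_intros]:
  assumes "(f has_real_derivative f') (at x within S)"
  shows "((\<lambda>x. cdf std_normal_distribution (f x)) has_real_derivative std_normal_density (f x) * f')
    (at x within S)"
proof -
  have "(cdf std_normal_distribution has_real_derivative std_normal_density x) (at x)" for x
  proof -
    \<comment> \<open>\<open>I\<close> is the distribution function on a window around
      \<open>x\<close>, written as an integral from a fixed base point so that the fundamental
      theorem of calculus applies.\<close>
    define I where "I y = cdf std_normal_distribution (x - 1) + integral {x - 1..y} std_normal_density" for y
    have "continuous_on {x - 1..x + 1} std_normal_density"
      unfolding normal_density_def by (intro continuous_intros) auto
    hence "((\<lambda>y. integral {x - 1..y} std_normal_density) has_real_derivative std_normal_density x)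
        (at x within {x - 1..x + 1})"
      by (rule integral_has_real_derivative) simp
    hence "(I has_real_derivative std_normal_density x) (at x within {x - 1..x + 1})"
      unfolding I_def by (auto intro!: derivative_eq_intros)
    hence "(I has_real_derivative std_normal_density x) (at x)"
      by (simp add: at_within_Icc_at)
    thus ?thesis
    proof (rule has_field_derivative_transform_within_open)
      show "I y = cdf std_normal_distribution y" if "y \<in> {x - 1<..<x + 1}" for y
        unfolding I_def using cdf_std_normal_diff[of "x - 1" y] that by simp
    qed auto
  qed
  from DERIV_chain'[OF assms this] show ?thesis by (simp add: mult.commute)
qed

text \<open>The density is even, so \<open>F x + F (- x)\<close> has derivative zero; its constant
  value is read off at infinity as 1 and at the origin as twice \<open>F 0\<close>.\<close>

lemma cdf_std_normal_zero: "cdf std_normal_distribution 0 = 1 / 2"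
proof -
  interpret real_distribution std_normal_distribution by (rule real_dist_normal_dist)
  let ?F = "cdf std_normal_distribution"
  have "((\<lambda>x. ?F x + ?F (- x)) has_real_derivative 0) (at x)" for x
  proof -
    have "((\<lambda>x. ?F x + ?F (- x)) has_real_derivative
        std_normal_density x * 1 + std_normal_density (- x) * - 1) (at x)"
      by (intro DERIV_add DERIV_cdf_std_normal DERIV_minus DERIV_ident)
    moreover have "std_normal_density x * 1 + std_normal_density (- x) * - 1 = 0"
      by (simp add: normal_density_def)
    ultimately show ?thesis by (simp only:)
  qed
  hence eq: "?F x + ?F (- x) = ?F 0 + ?F (- 0)" for x
    by (intro DERIV_isconst_all allI)
  have "((\<lambda>x. ?F x + ?F (- x)) \<longlongrightarrow> 1 + 0) at_top"
    by (intro tendsto_add cdf_lim_at_top_prob filterlim_compose[OF cdf_lim_at_bot filterlim_uminus_at_bot_at_top])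
  moreover have "(\<lambda>x. ?F x + ?F (- x)) = (\<lambda>x. ?F 0 + ?F (- 0))"
    using eq by (rule ext)
  ultimately have "((\<lambda>x::real. ?F 0 + ?F (- 0)) \<longlongrightarrow> 1 + 0) at_top"
    by (simp only:)
  hence "?F 0 + ?F (- 0) = 1 + 0" by (subst (asm) tendsto_const_iff) simp
  thus ?thesis by simp
qed

text \<open>The derivative of \<open>h\<close>: the factor 2 in front of the distribution function
  cancels the 1/2 in its argument.\<close>

definition h' :: "real \<Rightarrow> real \<Rightarrow> real" where
  "h' \<sigma> t = - \<sigma> * std_normal_density (\<sigma> * (1 - t) / 2)"

lemma DERIV_h [derivative_intros]:
  "(f has_real_derivative f') (at x within S) \<Longrightarrow>
    ((\<lambda>x. h \<sigma> (f x)) has_real_derivative h' \<sigma> (f x) * f') (at x within S)"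
  unfolding h_def [abs_def] h'_def by (auto intro!: derivative_eq_intros)

lemma continuous_on_h': "continuous_on A (h' \<sigma>)"
  unfolding h'_def normal_density_def by (intro continuous_intros) auto

lemma h_strict_antimono:
  assumes "0 < \<sigma>" "s < t"
  shows "h \<sigma> t < h \<sigma> s"
proof (rule DERIV_neg_imp_decreasing[OF assms(2)])
  fix x
  have "(h \<sigma> has_real_derivative h' \<sigma> x) (at x)"
    using DERIV_h[OF DERIV_ident, of \<sigma> x UNIV] by simp
  moreover have "h' \<sigma> x < 0"
    using assms(1) by (simp add: h'_def normal_density_pos)
  ultimately show "\<exists>y. (h \<sigma> has_real_derivative y) (at x) \<and> y < 0" by blast
qed

text \<open>\<open>h\<close> decreases strictly to its value 0 at time 1.\<close>

lemma h_pos: "0 < \<sigma> \<Longrightarrow> t < 1 \<Longrightarrow> 0 < h \<sigma> t"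
  using h_strict_antimono[of \<sigma> t 1] by (simp add: h_def cdf_std_normal_zero)

text \<open>Up to time 1 the argument of the density is nonnegative and moves towards the peak at 0,
  so the density grows; the minus sign in \<open>h'\<close> reverses this.\<close>

lemma h'_mono:
  assumes "0 < \<sigma>" "s \<le> t" "t \<le> 1"
  shows "h' \<sigma> t \<le> h' \<sigma> s"
proof -
  have "(\<sigma> * (1 - t) / 2)\<^sup>2 \<le> (\<sigma> * (1 - s) / 2)\<^sup>2"
    using assms by (intro power_mono) (auto intro!: mult_left_mono)
  thus ?thesis
    using assms(1) unfolding h'_def std_normal_density_def
    by (auto intro!: mult_left_mono divide_right_mono)
qed

section \<open>The weight \<open>\<psi>\<close>\<close>

text \<open>At time 1 the denominator vanishes and the quotient defaults to 0, so
  \<open>\<psi>\<close> carries its meaning only before time 1.\<close>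

definition \<psi> :: "real \<Rightarrow> real \<Rightarrow> real \<Rightarrow> real" where
  "\<psi> \<sigma> lam t = 1 + h' \<sigma> t / (lam * (h \<sigma> t)\<^sup>2)"

text \<open>The positive quantity \<open>- h'\<close> does not decrease, while \<open>h\<close>
  squared falls strictly.\<close>

lemma \<psi>_strict_antimono:
  assumes "0 < \<sigma>" "0 < lam" "s < t" "t < 1"
  shows "\<psi> \<sigma> lam t < \<psi> \<sigma> lam s"
proof -
  have pos: "0 < h \<sigma> t" "h \<sigma> t < h \<sigma> s" using assms by (auto intro: h_pos h_strict_antimono)
  have neg: "h' \<sigma> s < 0" "h' \<sigma> t \<le> h' \<sigma> s"
    using assms h'_mono[of \<sigma> s t] by (auto simp: h'_def normal_density_pos)
  have "- h' \<sigma> s / (lam * (h \<sigma> s)\<^sup>2) < - h' \<sigma> t / (lam * (h \<sigma> t)\<^sup>2)"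
    using pos neg assms(2) by (intro frac_less2) (auto intro!: mult_strict_left_mono power_strict_mono)
  thus ?thesis by (simp add: \<psi>_def)
qed

section \<open>Valuations and their perturbations\<close>

lemma valuation_is_valuation:
  assumes "control p"
  shows "is_valuation \<sigma> lam p (valuation \<sigma> lam p)"
proof -
  have eq: "valuation \<sigma> lam p t = exp (- lam * integral {0..t} (\<lambda>u. p u * h \<sigma> u))" if "t \<in> {0..1}" for t
    using valuation_unique(2)[OF assms is_valuation_exp[OF assms] that] .
  note v = is_valuation_exp[OF assms, of \<sigma> lam]
  show ?thesis unfolding is_valuation_def
  proof (intro conjI ballI)
    show "continuous_on {0..1} (valuation \<sigma> lam p)"
      using v unfolding is_valuation_def by (subst continuous_on_cong[OF refl eq]) auto
    show "valuation \<sigma> lam p 0 = 1" by (simp add: eq)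
    fix t :: real assume t: "t \<in> {0..<1}"
    \<comment> \<open>The explicit formula is known only on the unit interval, so the right
      derivative is taken within \<open>{t..1}\<close> before it is transferred.\<close>
    have "((\<lambda>t. exp (- lam * integral {0..t} (\<lambda>u. p u * h \<sigma> u))) has_real_derivative
        - lam * p t * h \<sigma> t * valuation \<sigma> lam p t) (at t within {t..1})"
      using v t eq[of t] unfolding is_valuation_def
      by (simp add: at_within_Icc_at_right)
    hence "(valuation \<sigma> lam p has_real_derivative
        - lam * p t * h \<sigma> t * valuation \<sigma> lam p t) (at t within {t..1})"
      by (rule has_field_derivative_transform_within[OF _ zero_less_one]) (use t eq in auto)
    thus "(valuation \<sigma> lam p has_real_derivative
        - lam * p t * h \<sigma> t * valuation \<sigma> lam p t) (at_right t)"
      using t by (simp add: at_within_Icc_at_right)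
  qed
qed

lemma valuation_pos:
  assumes "control p" "t \<in> {0..1}"
  shows "0 < valuation \<sigma> lam p t"
  using valuation_unique(1)[OF assms(1) valuation_is_valuation[OF assms(1)] assms(2)] by simp

lemma control_const_one: "control (\<lambda>_. 1)"
  by (auto simp: control_def intro: tendsto_const)

lemma is_valuation_sparing: "is_valuation \<sigma> lam (\<lambda>_. 1) (sparing_valuation \<sigma> lam)"
  using is_valuation_exp[OF control_const_one, of \<sigma> lam]
  by (simp add: sparing_valuation_def [abs_def] g_def [abs_def])

text \<open>The added term \<open>w' / (lam * h)\<close> lowers the logarithmic derivative of the
  state by exactly \<open>w'\<close>. Time 1, where \<open>h\<close> is 0, is excluded.\<close>

lemma is_valuation_times_exp:
  assumes "0 < \<sigma>" "0 < lam" "is_valuation \<sigma> lam p \<gamma>"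
    and w: "\<And>t. (w has_real_derivative w' t) (at t)" "w 0 = 0"
    and q: "\<And>t. t \<in> {0..<1} \<Longrightarrow> q t = p t + w' t / (lam * h \<sigma> t)"
  shows "is_valuation \<sigma> lam q (\<lambda>t. \<gamma> t * exp (- w t))"
  unfolding is_valuation_def
proof (intro conjI ballI)
  have "continuous_on A w" for A
    using w(1) by (meson DERIV_isCont continuous_at_imp_continuous_on)
  thus "continuous_on {0..1} (\<lambda>t. \<gamma> t * exp (- w t))"
    using assms(3) by (auto simp: is_valuation_def intro!: continuous_intros)
  show "\<gamma> 0 * exp (- w 0) = 1" using assms(3) w(2) by (simp add: is_valuation_def)
  fix t :: real assume t: "t \<in> {0..<1}"
  hence "h \<sigma> t > 0" using assms(1) by (auto intro: h_pos)
  hence "- lam * q t * h \<sigma> t = - lam * p t * h \<sigma> t - w' t"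
    using q[OF t] assms(2) by (simp add: field_simps)
  hence eq: "- lam * q t * h \<sigma> t * (\<gamma> t * exp (- w t)) =
      - lam * p t * h \<sigma> t * \<gamma> t * exp (- w t) - w' t * exp (- w t) * \<gamma> t"
    by (simp only: \<open>- lam * q t * h \<sigma> t = _\<close>) (simp add: algebra_simps)
  have "(\<gamma> has_real_derivative - lam * p t * h \<sigma> t * \<gamma> t) (at_right t)"
    using assms(3) t by (auto simp: is_valuation_def)
  moreover have "(w has_real_derivative w' t) (at_right t)"
    using w(1) by (rule has_field_derivative_at_within)
  ultimately show "((\<lambda>t. \<gamma> t * exp (- w t)) has_real_derivative
      - lam * q t * h \<sigma> t * (\<gamma> t * exp (- w t))) (at_right t)"
    unfolding eq by (auto intro!: derivative_eq_intros)
qed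

section \<open>Exact increment of the objective\<close>

lemma objective_integrable:
  assumes "control p"
  shows "(\<lambda>t. (1 - p t) * \<beta> * (sparing_valuation \<sigma> lam t - \<kappa> * valuation \<sigma> lam p t)) integrable_on {0..1}"
proof -
  define k where "k t = \<beta> * (sparing_valuation \<sigma> lam t - \<kappa> * valuation \<sigma> lam p t)" for t
  have k: "continuous_on {0..1} k"
    using is_valuation_sparing[of \<sigma> lam] valuation_is_valuation[OF assms, of \<sigma> lam]
    unfolding k_def is_valuation_def by (auto intro!: continuous_intros)
  have "(\<lambda>t. k t - p t * k t) integrable_on {0..1}"
    by (intro integrable_diff integrable_continuous_real k control_mult_integrable assms)
  thus ?thesis by (simp add: k_def algebra_simps)
qed

text \<open>The increment of the integrand differs from \<open>- \<psi> Z\<close> by the derivative of \<open>- Z / (\<lambda> h)\<close>,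
  and \<open>Z\<close> vanishes at \<open>a\<close> and \<open>b\<close>; this eliminates the control from the increment.\<close>

lemma objective_increment:
  fixes \<sigma> lam \<alpha> \<beta> a b :: real and p q w w' :: "real \<Rightarrow> real"
  defines "\<gamma>1 \<equiv> sparing_valuation \<sigma> lam" and "\<gamma> \<equiv> valuation \<sigma> lam p" and "\<kappa> \<equiv> 1 - \<alpha> / \<beta>"
  defines "Z \<equiv> \<lambda>t. w t * \<gamma>1 t + \<kappa> * \<gamma> t * (exp (- w t) - 1)"
  assumes pos: "0 < \<sigma>" "0 < lam" and p: "control p" and q: "control q"
    and ab: "0 \<le> a" "a < b" "b < 1"
    and w: "\<And>t. (w has_real_derivative w' t) (at t)" "continuous_on UNIV w'"
    and outside: "\<And>t. t \<notin> {a<..<b} \<Longrightarrow> w t = 0 \<and> w' t = 0"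
    and q_eq: "\<And>t. t \<in> {0..1} \<Longrightarrow> q t = p t + w' t / (lam * h \<sigma> t)"
  shows "objective \<sigma> lam \<alpha> \<beta> q - objective \<sigma> lam \<alpha> \<beta> p = - \<beta> * integral {a..b} (\<lambda>t. \<psi> \<sigma> lam t * Z t)"
proof -
  note \<gamma>1 = is_valuation_sparing[of \<sigma> lam, folded \<gamma>1_def]
  note \<gamma> = valuation_is_valuation[OF p, of \<sigma> lam, folded \<gamma>_def]
  have cont_\<gamma>: "continuous_on {0..1} \<gamma>1" "continuous_on {0..1} \<gamma>"
    using \<gamma>1 \<gamma> by (auto simp: is_valuation_def)
  have w0: "w 0 = 0" using outside ab by auto
  have cont_w: "continuous_on A w" for A
    using w(1) by (meson DERIV_isCont continuous_at_imp_continuous_on)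
  have cont_w': "continuous_on A w'" for A
    using w(2) continuous_on_subset by blast
  have val_q: "valuation \<sigma> lam q t = \<gamma> t * exp (- w t)" if "t \<in> {0..1}" for t
    using is_valuation_times_exp[OF pos \<gamma> w(1) w0, of q] q_eq that
    by (intro valuation_unique(2)[OF q]) auto
  \<comment> \<open>Freezing \<open>h\<close> at \<open>b\<close> keeps the denominators away from
    the zero of \<open>h\<close> at time 1. Nothing is lost, since \<open>w\<close> and
    \<open>w'\<close> vanish from \<open>b\<close> on.\<close>
  define k where "k t = h \<sigma> (min t b)" for t
  have k_pos: "k t > 0" for t
    using pos(1) ab unfolding k_def by (intro h_pos) auto
  have cont_k: "continuous_on {0..1} k" unfolding k_def
    by (intro continuous_on_compose2[OF continuous_on_h[of UNIV]] continuous_intros) auto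
  have k_eq: "k t = h \<sigma> t" if "t \<le> b" for t using that by (simp add: k_def)
  define v where "v t = w' t / (lam * k t)" for t
  have qv: "q t = p t + v t" if "t \<in> {0..1}" for t
  proof (cases "t < b")
    case False
    thus ?thesis using q_eq[OF that] outside[of t] by (simp add: v_def)
  qed (use q_eq[OF that] in \<open>simp add: v_def k_eq\<close>)
  \<comment> \<open>The increment of the integrand divided by \<open>\<beta>\<close>, arranged so
    that \<open>p\<close> enters only as a factor of the continuous function \<open>k0\<close>;
    \<open>k1\<close> collects the rest, and \<open>k2\<close> extends \<open>\<psi> Z\<close>
    continuously beyond \<open>b\<close>.\<close>
  define f where "f t = p t * (\<kappa> * \<gamma> t * (exp (- w t) - 1)) +
      ((1 - v t) * (\<gamma>1 t - \<kappa> * (\<gamma> t * exp (- w t))) - (\<gamma>1 t - \<kappa> * \<gamma> t))" for t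
  define k0 where "k0 t = \<kappa> * \<gamma> t * (exp (- w t) - 1)" for t
  define k1 where "k1 t = (1 - v t) * (\<gamma>1 t - \<kappa> * (\<gamma> t * exp (- w t))) - (\<gamma>1 t - \<kappa> * \<gamma> t)" for t
  define k2 where "k2 t = (1 + h' \<sigma> t / (lam * (k t)\<^sup>2)) * Z t" for t
  have nz: "k t \<noteq> 0" "lam \<noteq> 0" for t using k_pos[of t] pos(2) by auto
  have cont_v: "continuous_on {0..1} v" unfolding v_def
    using nz by (intro continuous_intros cont_k cont_w') auto
  have cont0: "continuous_on {0..1} k0" unfolding k0_def
    by (intro continuous_intros cont_\<gamma> cont_w)
  have cont1: "continuous_on {0..1} k1" unfolding k1_def
    by (intro continuous_intros cont_\<gamma> cont_w cont_v)
  have cont2: "continuous_on {0..1} k2" unfolding k2_def Z_def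
    using nz by (intro continuous_intros cont_\<gamma> cont_w cont_k continuous_on_h') auto
  note int0 = control_mult_integrable[OF p cont0]
  have int1: "k1 integrable_on {0..1}" using cont1 by (rule integrable_continuous_real)
  have int2: "k2 integrable_on {0..1}" using cont2 by (rule integrable_continuous_real)
  have f_eq: "f = (\<lambda>t. p t * k0 t + k1 t)" by (simp add: fun_eq_iff f_def k0_def k1_def)
  have sub: "{a..b} \<subseteq> {0..1}" using ab by auto
  have int_f: "f integrable_on {0..1}" unfolding f_eq
    by (intro integrable_add int0 int1)
  have f0: "f t = 0" if "t \<notin> {a<..<b}" for t
    using outside[OF that] by (simp add: f_def v_def)
  have "objective \<sigma> lam \<alpha> \<beta> q - objective \<sigma> lam \<alpha> \<beta> p =
      integral {0..1} (\<lambda>t. (1 - q t) * \<beta> * (\<gamma>1 t - \<kappa> * valuation \<sigma> lam q t) - (1 - p t) * \<beta> * (\<gamma>1 t - \<kappa> * \<gamma> t))"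
    unfolding objective_def Let_def \<gamma>1_def \<gamma>_def \<kappa>_def
    by (intro integral_diff[symmetric] objective_integrable p q)
  also have "\<dots> = integral {0..1} (\<lambda>t. \<beta> * f t)"
    by (intro integral_cong) (simp add: val_q qv f_def algebra_simps)
  also have "\<dots> = \<beta> * integral {0..1} f" by simp
  also have "integral {0..1} f = integral {a..b} f"
  proof (rule integral_unique)
    have "f integrable_on {a..b}" using int_f sub by (rule integrable_subinterval_real)
    thus "(f has_integral integral {a..b} f) {0..1}"
      using sub f0 by (intro has_integral_on_superset[OF integrable_integral]) auto
  qed
  also have "integral {a..b} f = - integral {a..b} k2"
  proof -
    \<comment> \<open>A primitive of \<open>f + k2\<close> plus \<open>Z / (lam * k)\<close>. Once
      \<open>F\<close> is seen to be constant, the integral of \<open>f + k2\<close> equals boundary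
      terms of \<open>Z\<close>, which are 0. The factor 1 is the constant control, so that
      \<open>control_integral\<close> serves both integrals.\<close>
    define F where "F t = integral {0..t} (\<lambda>u. p u * k0 u) + integral {0..t} (\<lambda>u. 1 * (k1 u + k2 u)) +
        Z t / (lam * k t)" for t
    have cont12: "continuous_on {0..1} (\<lambda>t. k1 t + k2 t)" by (intro continuous_intros cont1 cont2)
    note c0 = control_integral[OF p cont0]
    note c12 = control_integral[OF control_const_one cont12]
    have "F b = F a"
    proof (rule right_derivative_zero_imp_const[where f = F])
      have "continuous_on {0..1} F" unfolding F_def Z_def
        using nz by (intro continuous_intros c0(1) c12(1) cont_\<gamma> cont_w cont_k) auto
      thus "continuous_on {a..b} F" using sub by (rule continuous_on_subset)
      fix t assume t: "t \<in> {a..<b}"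
      hence t01: "t \<in> {0..<1}" using ab by auto
      \<comment> \<open>\<open>k\<close> may have a corner at \<open>b\<close>, but to the right of
        \<open>t < b\<close> it agrees with \<open>h\<close> for a while.\<close>
      have kd: "(k has_real_derivative h' \<sigma> t) (at_right t)"
      proof -
        have "(h \<sigma> has_real_derivative h' \<sigma> t) (at t within {t..b})"
          using DERIV_h[OF DERIV_ident, of \<sigma> t "{t..b}"] by simp
        hence "(k has_real_derivative h' \<sigma> t) (at t within {t..b})"
          by (rule has_field_derivative_transform_within[OF _ zero_less_one]) (use t in \<open>auto simp: k_eq\<close>)
        thus ?thesis using t by (simp add: at_within_Icc_at_right)
      qed
      have d1: "(\<gamma>1 has_real_derivative - lam * k t * \<gamma>1 t) (at_right t)"
        and d2: "(\<gamma> has_real_derivative - lam * p t * k t * \<gamma> t) (at_right t)"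
        using \<gamma>1 \<gamma> t01 t k_eq[of t] by (auto simp: is_valuation_def)
      have d3: "(w has_real_derivative w' t) (at_right t)"
        using w(1) by (rule has_field_derivative_at_within)
      define Z' where "Z' = w' t * \<gamma>1 t - w t * lam * k t * \<gamma>1 t - lam * p t * k t * \<kappa> * \<gamma> t * (exp (- w t) - 1)
          - \<kappa> * \<gamma> t * exp (- w t) * w' t"
      have dZ: "(Z has_real_derivative Z') (at_right t)" unfolding Z_def Z'_def
        by (auto intro!: derivative_eq_intros d1 d2 d3 simp: algebra_simps)
      have "(F has_real_derivative p t * k0 t + 1 * (k1 t + k2 t) +
          (Z' * (lam * k t) - Z t * (lam * h' \<sigma> t)) / (lam * k t * (lam * k t))) (at_right t)"
        unfolding F_def using nz
        by (intro DERIV_add c0(2) c12(2) t01 DERIV_divide dZ DERIV_cmult kd) auto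
      \<comment> \<open>The term of \<open>Z'\<close> containing \<open>p\<close> cancels
        \<open>p t * k0 t\<close>, the \<open>v\<close> terms cancel as well, and what remains is
        \<open>- Z t + Z t\<close>.\<close>
      moreover have "p t * k0 t + 1 * (k1 t + k2 t) +
          (Z' * (lam * k t) - Z t * (lam * h' \<sigma> t)) / (lam * k t * (lam * k t)) = 0"
      proof -
        have "(Z' * (lam * k t) - Z t * (lam * h' \<sigma> t)) / (lam * k t * (lam * k t)) =
            Z' / (lam * k t) - h' \<sigma> t / (lam * (k t)\<^sup>2) * Z t"
          using nz(1)[of t] nz(2) by (simp add: field_simps power2_eq_square)
        moreover have "Z' / (lam * k t) = v t * (\<gamma>1 t - \<kappa> * \<gamma> t * exp (- w t)) - w t * \<gamma>1 t
            - p t * \<kappa> * \<gamma> t * (exp (- w t) - 1)"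
          using nz(1)[of t] nz(2) unfolding Z'_def v_def by (simp add: field_simps)
        ultimately show ?thesis
          unfolding k0_def k1_def k2_def Z_def by (simp add: algebra_simps)
      qed
      ultimately show "(F has_real_derivative 0) (at_right t)" by simp
    qed (use ab in simp)
    moreover have "Z a = 0" "Z b = 0" using outside[of a] outside[of b] by (auto simp: Z_def)
    moreover have "F b - F a = integral {a..b} f + integral {a..b} k2 + (Z b / (lam * k b) - Z a / (lam * k a))"
    proof -
      have *: "integral {0..b} r - integral {0..a} r = integral {a..b} r" if "r integrable_on {0..1}" for r :: "real \<Rightarrow> real"
        using Henstock_Kurzweil_Integration.integral_combine[of 0 a b r] ab
          integrable_subinterval_real[OF that, of 0 b] by auto
      have **: "r integrable_on {a..b}" if "r integrable_on {0..1}" for r :: "real \<Rightarrow> real"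
        using that sub by (rule integrable_subinterval_real)
      have "integral {0..b} (\<lambda>u. k1 u + k2 u) - integral {0..a} (\<lambda>u. k1 u + k2 u) = integral {a..b} k1 + integral {a..b} k2"
        using *[OF integrable_add[OF int1 int2]] integral_add[OF **[OF int1] **[OF int2]] by simp
      thus ?thesis
        using *[OF int0] integral_add[OF **[OF int0] **[OF int1]] by (simp add: F_def f_eq)
    qed
    ultimately show ?thesis by simp
  qed
  also have "integral {a..b} k2 = integral {a..b} (\<lambda>t. \<psi> \<sigma> lam t * Z t)"
    by (intro integral_cong) (simp add: k2_def \<psi>_def k_eq)
  finally show ?thesis by simp
qed

section \<open>Tools for small admissible perturbations\<close>

text \<open>Controls the gap between the exact increment and its first-order part. The upper bound
  comes from \<open>exp x \<ge> 1 + x\<close> by taking reciprocals.\<close>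

lemma exp_second_order_remainder:
  fixes x :: real
  assumes "\<bar>x\<bar> \<le> 1 / 2"
  shows "0 \<le> exp (- x) - 1 + x" and "exp (- x) - 1 + x \<le> 2 * x\<^sup>2"
proof -
  show "0 \<le> exp (- x) - 1 + x" using exp_ge_add_one_self[of "- x"] by simp
  have "exp (- x) \<le> 1 / (1 + x)"
    using exp_ge_add_one_self[of x] assms by (simp add: exp_minus inverse_eq_divide frac_le)
  also have "\<dots> = 1 - x + x\<^sup>2 / (1 + x)"
    using assms by (simp add: field_simps power2_eq_square)
  also have "x\<^sup>2 / (1 + x) \<le> x\<^sup>2 / (1 / 2)"
    using assms by (intro divide_left_mono) auto
  finally show "exp (- x) - 1 + x \<le> 2 * x\<^sup>2" by simp
qed

lemma continuous_on_bounded_interval: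
  fixes f :: "real \<Rightarrow> real"
  assumes "continuous_on {a..b} f"
  obtains M where "M > 0" "\<And>t. t \<in> {a..b} \<Longrightarrow> \<bar>f t\<bar> \<le> M"
proof -
  have "bounded (f ` {a..b})"
    using assms by (intro compact_imp_bounded compact_continuous_image) auto
  thus ?thesis using that by (auto simp: bounded_pos)
qed

text \<open>Squaring smooths the corner of the positive part; this yields a compactly supported bump
  with continuous derivative.\<close>

lemma DERIV_max_0_square:
  "((\<lambda>x. (max 0 x)\<^sup>2) has_real_derivative 2 * max 0 x) (at (x::real))"
proof -
  consider "x < 0" | "x = 0" | "x > 0" by linarith
  thus ?thesis
  proof cases
    case 1
    have "((\<lambda>x. 0) has_real_derivative 2 * max 0 x) (at x)" using 1 by simp
    thus ?thesis
      by (rule has_field_derivative_transform_within_open[of _ _ _ "{..<0}"]) (use 1 in auto)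
  next
    case 2
    have "((\<lambda>y. (max 0 y)\<^sup>2 / y) \<longlongrightarrow> 0) (at (0::real))"
    proof (rule Lim_null_comparison)
      have "norm ((max 0 y)\<^sup>2 / y) \<le> \<bar>y\<bar>" for y :: real
        by (cases "y > 0") (auto simp: max_def power2_eq_square)
      thus "\<forall>\<^sub>F y in at (0::real). norm ((max 0 y)\<^sup>2 / y) \<le> \<bar>y\<bar>" by simp
      show "((\<lambda>y::real. \<bar>y\<bar>) \<longlongrightarrow> 0) (at 0)" by (auto intro!: tendsto_eq_intros)
    qed
    thus ?thesis using 2 by (simp add: has_field_derivative_iff)
  next
    case 3
    have "((\<lambda>x. x\<^sup>2) has_real_derivative 2 * max 0 x) (at x)"
      using 3 by (auto intro!: derivative_eq_intros)
    thus ?thesis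
      by (rule has_field_derivative_transform_within_open[of _ _ _ "{0<..}"]) (use 3 in auto)
  qed
qed

lemma control_add_continuous:
  assumes p: "control p" and v: "continuous_on UNIV v"
    and range: "\<And>t. t \<in> {0..1} \<Longrightarrow> p t + v t \<in> {0..1}"
  shows "control (\<lambda>t. p t + v t)"
proof -
  have v': "(v \<longlongrightarrow> v t) (at t within S)" for t S
    using v by (metis continuous_on_def continuous_on_subset[OF v subset_UNIV]
        UNIV_I tendsto_within_subset subset_UNIV)
  show ?thesis unfolding control_def
  proof (intro conjI ballI)
    show "(\<lambda>t. p t + v t) ` {0..1} \<subseteq> {0..1}" using range by auto
    fix t :: real assume "t \<in> {0..<1}"
    thus "continuous (at_right t) (\<lambda>t. p t + v t)"
      using p v' by (auto simp: control_def continuous_within intro!: tendsto_add)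
  next
    fix t :: real assume "t \<in> {0<..1}"
    then obtain l where "(p \<longlongrightarrow> l) (at_left t)" using p unfolding control_def by blast
    from tendsto_add[OF this v'] show "\<exists>l. ((\<lambda>t. p t + v t) \<longlongrightarrow> l) (at_left t)" by blast
  qed
qed

lemma mult_abs_le_of_le_divide:
  fixes e M x \<tau> :: real
  assumes "0 < M" "0 \<le> \<tau>" "\<tau> \<le> e / M" "\<bar>x\<bar> \<le> M"
  shows "\<tau> * \<bar>x\<bar> \<le> e"
proof -
  have "\<tau> * \<bar>x\<bar> \<le> \<tau> * M" using assms by (intro mult_left_mono)
  also have "\<dots> \<le> e" using assms by (simp add: field_simps)
  finally show ?thesis .
qed

section \<open>First-order condition at a mixing time\<close>

text \<open>Mixing at the single time \<open>a\<close> suffices: by right-continuity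
  \<open>p\<close> stays away from 0 and 1 shortly after \<open>a\<close>. If the product were
  nonzero, it would keep its sign there, and a small bump of the opposite sign would raise the
  objective.\<close>

lemma optimal_stationary:
  assumes pos: "0 < \<sigma>" "0 < lam" and \<alpha>\<beta>: "0 < \<alpha>" "\<alpha> < \<beta>"
    and opt: "optimal_control \<sigma> lam \<alpha> \<beta> p"
    and a: "a \<in> {0..<1}" and mixing: "p a \<in> {0<..<1}"
  shows "\<psi> \<sigma> lam a * (sparing_valuation \<sigma> lam a - (1 - \<alpha> / \<beta>) * valuation \<sigma> lam p a) = 0"
proof (rule ccontr)
  define \<kappa> where "\<kappa> = 1 - \<alpha> / \<beta>"
  define \<gamma>1 where "\<gamma>1 = sparing_valuation \<sigma> lam"
  define \<gamma> where "\<gamma> = valuation \<sigma> lam p"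
  define c where "c t = \<psi> \<sigma> lam t * (\<gamma>1 t - \<kappa> * \<gamma> t)" for t
  assume "\<not> ?thesis"
  hence ca: "c a \<noteq> 0" by (simp add: c_def \<gamma>1_def \<gamma>_def \<kappa>_def)
  have p: "control p" using opt by (simp add: optimal_control_def)
  have cont_\<gamma>: "continuous_on {0..1} \<gamma>1" "continuous_on {0..1} \<gamma>"
    using is_valuation_sparing[of \<sigma> lam] valuation_is_valuation[OF p, of \<sigma> lam]
    by (auto simp: is_valuation_def \<gamma>1_def \<gamma>_def)
  have h_nz: "h \<sigma> t \<noteq> 0" if "t < 1" for t using h_pos[OF pos(1) that] by simp
  have cont_\<psi>: "continuous_on {0..<1} (\<psi> \<sigma> lam)" unfolding \<psi>_def
    using h_nz pos(2) by (intro continuous_intros continuous_on_h continuous_on_h') auto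
  have cont_c: "continuous_on {0..<1} c" unfolding c_def
    by (intro continuous_intros cont_\<psi> continuous_on_subset[OF cont_\<gamma>(1)] continuous_on_subset[OF cont_\<gamma>(2)]) auto
  \<comment> \<open>Half the distance from \<open>p a\<close> to the ends: a deviation below
    \<open>e\<close> still leaves room \<open>e\<close> on both sides.\<close>
  define e where "e = min (p a) (1 - p a) / 2"
  have e: "e > 0" using mixing by (simp add: e_def)
  have "\<forall>\<^sub>F t in at_right a. dist (p t) (p a) < e"
    using p a e by (intro tendstoD) (auto simp: control_def continuous_within)
  moreover have "\<forall>\<^sub>F t in at_right a. dist (c t) (c a) < \<bar>c a\<bar>"
  proof (rule tendstoD)
    have "(c \<longlongrightarrow> c a) (at a within {0..<1})"
      using cont_c a by (auto simp: continuous_on_def)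
    hence "(c \<longlongrightarrow> c a) (at a within {a..<1})"
      by (rule tendsto_within_subset) (use a in auto)
    moreover have "at a within {a..<1} = at_right a"
      using a by (intro at_within_nhd[of _ "{..<1}"]) auto
    ultimately show "(c \<longlongrightarrow> c a) (at_right a)" by simp
  qed (use ca in simp)
  moreover have "\<forall>\<^sub>F t in at_right a. t < 1"
    using a by (intro order_tendstoD[OF tendsto_ident_at]) auto
  ultimately have "\<forall>\<^sub>F t in at_right a. dist (p t) (p a) < e \<and> dist (c t) (c a) < \<bar>c a\<bar> \<and> t < 1"
    by eventually_elim simp
  then obtain d where d: "a < d" "\<And>t. a < t \<Longrightarrow> t < d \<Longrightarrow> dist (p t) (p a) < e \<and> dist (c t) (c a) < \<bar>c a\<bar> \<and> t < 1"
    by (auto simp: eventually_at_right_field)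
  define b where "b = (a + d) / 2"
  have ab: "a < b" "b < d" using d(1) by (auto simp: b_def)
  have b1: "b < 1" using d(2)[of b] ab by simp
  have near: "e \<le> p t \<and> p t \<le> 1 - e \<and> sgn (c a) * c t > 0" if "t \<in> {a..b}" for t
  proof -
    have "\<bar>p t - p a\<bar> < e \<and> \<bar>c t - c a\<bar> < \<bar>c a\<bar>"
      using d(2)[of t] that ab e ca by (cases "t = a") (auto simp: dist_real_def)
    moreover have "2 * e \<le> p a" "2 * e \<le> 1 - p a" by (auto simp: e_def)
    ultimately show ?thesis by (auto simp: sgn_real_def abs_real_def split: if_splits)
  qed
  \<comment> \<open>\<open>W\<close> is positive exactly inside \<open>{a<..<b}\<close>, and it
    vanishes elsewhere together with its derivative.\<close>
  define m where "m t = max 0 ((t - a) * (b - t))" for t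
  define W where "W t = (m t)\<^sup>2" for t
  define W' where "W' t = 2 * m t * (a + b - 2 * t)" for t
  have dW: "(W has_real_derivative W' t) (at t)" for t
  proof -
    have "((\<lambda>t. (t - a) * (b - t)) has_real_derivative a + b - 2 * t) (at t)"
      by (auto intro!: derivative_eq_intros)
    from DERIV_chain'[OF this DERIV_max_0_square] show ?thesis
      by (simp add: W_def [abs_def] W'_def m_def mult.commute)
  qed
  have cont_W: "continuous_on A W" for A
    using dW by (meson DERIV_isCont continuous_at_imp_continuous_on)
  have cont_W': "continuous_on A W'" for A
    unfolding W'_def m_def by (intro continuous_intros)
  have outside: "W t = 0 \<and> W' t = 0" if "t \<notin> {a<..<b}" for t
  proof -
    have "(t - a) * (b - t) \<le> 0" using that ab by (auto simp: mult_le_0_iff)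
    thus ?thesis by (simp add: W_def W'_def m_def)
  qed
  have W_nonneg: "W t \<ge> 0" for t by (simp add: W_def)
  have W_pos: "W t > 0" if "t \<in> {a<..<b}" for t
    using that by (simp add: W_def m_def max_def)
  define V where "V t = W' t / (lam * h \<sigma> (min t b))" for t
  have cont_V: "continuous_on A V" for A unfolding V_def
    using h_nz b1 pos(2)
    by (intro continuous_intros cont_W' continuous_on_compose2[OF continuous_on_h[of UNIV]]) auto
  \<comment> \<open>Chosen so that the second-order error of a bump of size \<open>\<tau>\<close> is
    at most \<open>\<tau> * W t * (\<tau> * D t)\<close>.\<close>
  define D where "D t = 2 * \<kappa> * \<gamma> t * \<bar>\<psi> \<sigma> lam t\<bar> * W t" for t
  have sub: "{a..b} \<subseteq> {0..1}" "{a..b} \<subseteq> {0..<1}" using a b1 by auto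
  have cont_D: "continuous_on {a..b} D" unfolding D_def
    by (intro continuous_intros cont_W continuous_on_subset[OF cont_\<gamma>(2) sub(1)]
        continuous_on_subset[OF cont_\<psi> sub(2)])
  obtain M1 where M1: "M1 > 0" "\<And>t. t \<in> {a..b} \<Longrightarrow> \<bar>V t\<bar> \<le> M1"
    using continuous_on_bounded_interval[OF cont_V] by blast
  obtain M2 where M2: "M2 > 0" "\<And>t. t \<in> {a..b} \<Longrightarrow> \<bar>W t\<bar> \<le> M2"
    using continuous_on_bounded_interval[OF cont_W] by blast
  obtain M3 where M3: "M3 > 0" "\<And>t. t \<in> {a..b} \<Longrightarrow> \<bar>D t\<bar> \<le> M3"
    using continuous_on_bounded_interval[OF cont_D] by blast
  have "continuous_on {a..b} (\<lambda>t. sgn (c a) * c t)"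
    by (intro continuous_intros continuous_on_subset[OF cont_c sub(2)])
  from continuous_attains_inf[OF compact_Icc _ this] ab
  obtain x where x: "x \<in> {a..b}" "\<And>t. t \<in> {a..b} \<Longrightarrow> sgn (c a) * c x \<le> sgn (c a) * c t" by auto
  define \<eta> where "\<eta> = sgn (c a) * c x"
  have \<eta>: "\<eta> > 0" using near[OF x(1)] by (simp add: \<eta>_def)
  \<comment> \<open>The three bounds keep the new control in \<open>{0..1}\<close>, bring the
    exponent into the range of the remainder estimate, and hold the second-order error to half of
    the first-order gain.\<close>
  define \<tau> where "\<tau> = Min {e / M1, (1 / 2) / M2, (\<eta> / 2) / M3}"
  have \<tau>: "\<tau> > 0" "\<tau> \<le> e / M1" "\<tau> \<le> (1 / 2) / M2" "\<tau> \<le> (\<eta> / 2) / M3"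
    using e M1(1) M2(1) M3(1) \<eta> by (auto simp: \<tau>_def)
  define s where "s = - sgn (c a) * \<tau>"
  have abs_s: "\<bar>s\<bar> = \<tau>" using \<tau>(1) ca by (simp add: s_def abs_mult abs_sgn_eq)
  have sV: "\<bar>s * V t\<bar> \<le> e" if "t \<in> {a..b}" for t
    using mult_abs_le_of_le_divide[OF M1(1) _ \<tau>(2) M1(2)[OF that]] \<tau>(1) by (simp add: abs_mult abs_s)
  have sW: "\<bar>s * W t\<bar> \<le> 1 / 2" if "t \<in> {a..b}" for t
    using mult_abs_le_of_le_divide[OF M2(1) _ \<tau>(3) M2(2)[OF that]] \<tau>(1) by (simp add: abs_mult abs_s)
  have \<tau>D: "\<tau> * D t \<le> \<eta> / 2" if "t \<in> {a..b}" for t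
  proof -
    have "\<tau> * D t \<le> \<tau> * \<bar>D t\<bar>" using \<tau>(1) by (intro mult_left_mono) auto
    also have "\<dots> \<le> \<eta> / 2" using mult_abs_le_of_le_divide[OF M3(1) _ \<tau>(4) M3(2)[OF that]] \<tau>(1) by simp
    finally show ?thesis .
  qed
  define q where "q t = p t + s * V t" for t
  have q: "control q" unfolding q_def
  proof (rule control_add_continuous[OF p])
    show "continuous_on UNIV (\<lambda>t. s * V t)" by (intro continuous_intros cont_V)
    fix t :: real assume t: "t \<in> {0..1}"
    show "p t + s * V t \<in> {0..1}"
    proof (cases "t \<in> {a..b}")
      case True
      thus ?thesis using near[OF True] sV[OF True] by auto
    next
      case False
      hence "V t = 0" using outside[of t] by (auto simp: V_def)
      thus ?thesis using t p by (simp add: control_def image_subset_iff)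
    qed
  qed
  define Z where "Z t = s * W t * \<gamma>1 t + \<kappa> * \<gamma> t * (exp (- (s * W t)) - 1)" for t
  have incr: "objective \<sigma> lam \<alpha> \<beta> q - objective \<sigma> lam \<alpha> \<beta> p = - \<beta> * integral {a..b} (\<lambda>t. \<psi> \<sigma> lam t * Z t)"
    unfolding Z_def \<gamma>1_def \<gamma>_def \<kappa>_def
  proof (rule objective_increment[OF pos p q _ ab(1) b1])
    show "((\<lambda>t. s * W t) has_real_derivative s * W' t) (at t)" for t
      by (intro DERIV_cmult dW)
    show "continuous_on UNIV (\<lambda>t. s * W' t)" by (intro continuous_intros cont_W')
    show "s * W t = 0 \<and> s * W' t = 0" if "t \<notin> {a<..<b}" for t using outside[OF that] by simp
    show "q t = p t + s * W' t / (lam * h \<sigma> t)" if "t \<in> {0..1}" for t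
      using outside[of t] by (cases "t < b") (auto simp: q_def V_def)
  qed (use a in auto)
  have "objective \<sigma> lam \<alpha> \<beta> q \<le> objective \<sigma> lam \<alpha> \<beta> p"
    using opt q by (simp add: optimal_control_def)
  hence "0 \<le> \<beta> * integral {a..b} (\<lambda>t. \<psi> \<sigma> lam t * Z t)"
    using incr by simp
  hence int_nonneg: "integral {a..b} (\<lambda>t. \<psi> \<sigma> lam t * Z t) \<ge> 0"
    using \<alpha>\<beta> by (simp add: zero_le_mult_iff)
  \<comment> \<open>The factor \<open>W t\<close> is kept in both terms, because \<open>W\<close>
    has no positive lower bound near \<open>a\<close> and \<open>b\<close>.\<close>
  have bound: "\<psi> \<sigma> lam t * Z t \<le> - \<tau> * W t * (\<eta> / 2)" if t: "t \<in> {a..b}" for t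
  proof -
    let ?R = "exp (- (s * W t)) - 1 + s * W t"
    have \<kappa>\<gamma>: "\<kappa> * \<gamma> t \<ge> 0"
      using valuation_pos[OF p, of t \<sigma> lam] sub(1) t \<alpha>\<beta> by (auto simp: \<kappa>_def \<gamma>_def)
    have R: "0 \<le> ?R" "?R \<le> 2 * (s * W t)\<^sup>2"
      using exp_second_order_remainder[OF sW[OF t]] by auto
    have s2: "s * s = \<tau> * \<tau>" using abs_s by (metis abs_mult_self_eq)
    have eq: "\<psi> \<sigma> lam t * Z t = s * W t * c t + \<kappa> * \<gamma> t * \<psi> \<sigma> lam t * ?R"
      by (simp add: Z_def c_def algebra_simps)
    have "\<kappa> * \<gamma> t * \<psi> \<sigma> lam t * ?R \<le> \<kappa> * \<gamma> t * \<bar>\<psi> \<sigma> lam t\<bar> * ?R"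
      by (rule mult_right_mono[OF mult_left_mono[OF abs_ge_self \<kappa>\<gamma>] R(1)])
    also have "\<dots> \<le> \<kappa> * \<gamma> t * \<bar>\<psi> \<sigma> lam t\<bar> * (2 * (s * W t)\<^sup>2)"
      by (rule mult_left_mono[OF R(2) mult_nonneg_nonneg[OF \<kappa>\<gamma> abs_ge_zero]])
    also have "\<dots> = \<tau> * W t * (\<tau> * D t)"
      by (simp add: D_def power_mult_distrib s2 power2_eq_square)
    also have "\<dots> \<le> \<tau> * W t * (\<eta> / 2)"
      using \<tau>(1) W_nonneg \<tau>D[OF t] by (intro mult_left_mono) auto
    finally have second: "\<kappa> * \<gamma> t * \<psi> \<sigma> lam t * ?R \<le> \<tau> * W t * (\<eta> / 2)" .
    have "\<tau> * W t * \<eta> \<le> \<tau> * W t * (sgn (c a) * c t)"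
      using x(2)[OF t] \<tau>(1) W_nonneg by (intro mult_left_mono) (auto simp: \<eta>_def)
    moreover have "s * W t * c t = - (\<tau> * W t * (sgn (c a) * c t))" by (simp add: s_def)
    ultimately show ?thesis using eq second by simp
  qed
  have nonpos: "0 \<le> - (\<psi> \<sigma> lam t * Z t)" if "t \<in> {a..b}" for t
  proof -
    have "0 \<le> \<tau> * W t * (\<eta> / 2)" using \<tau>(1) \<eta> W_nonneg by auto
    thus ?thesis using bound[OF that] by simp
  qed
  have cont: "continuous_on {a..b} (\<lambda>t. - (\<psi> \<sigma> lam t * Z t))" unfolding Z_def
    by (intro continuous_intros cont_W continuous_on_subset[OF cont_\<gamma>(1) sub(1)]
        continuous_on_subset[OF cont_\<gamma>(2) sub(1)] continuous_on_subset[OF cont_\<psi> sub(2)])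
  \<comment> \<open>The integrand \<open>\<psi> Z\<close> is nonpositive but its integral is
    nonnegative, so by continuity it vanishes; at the midpoint this contradicts the strict
    bound.\<close>
  have "integral {a..b} (\<lambda>t. - (\<psi> \<sigma> lam t * Z t)) \<ge> 0"
    by (intro integral_nonneg integrable_continuous_real cont nonpos)
  hence "integral {a..b} (\<lambda>t. - (\<psi> \<sigma> lam t * Z t)) = 0"
    using int_nonneg by simp
  hence zero: "\<psi> \<sigma> lam t * Z t = 0" if "t \<in> {a..b}" for t
    using integral_eq_0_iff[OF cont ab(1) nonpos] that by auto
  have mid: "(a + b) / 2 \<in> {a..b}" using ab by simp
  have "0 \<le> - \<tau> * W ((a + b) / 2) * (\<eta> / 2)"
    using bound[OF mid] unfolding zero[OF mid] .
  moreover have "\<tau> * W ((a + b) / 2) * (\<eta> / 2) > 0"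
    using \<tau>(1) \<eta> W_pos[of "(a + b) / 2"] ab by (intro mult_pos_pos) auto
  ultimately show False by linarith
qed

section \<open>Excluding mixing on an interval\<close>

text \<open>Differentiating the identity from the right gives two values of the same derivative,
  which differ only by the factor \<open>p t\<close>; the common factor is nonzero.\<close>

lemma control_one_of_proportional:
  assumes "0 < \<sigma>" "0 < lam" and p: "control p" and cd: "0 \<le> c" "c < d" "d \<le> 1"
    and eq: "\<And>t. t \<in> {c<..<d} \<Longrightarrow> sparing_valuation \<sigma> lam t = \<kappa> * valuation \<sigma> lam p t"
    and t: "t \<in> {c<..<d}"
  shows "p t = 1"
proof -
  let ?\<gamma>1 = "sparing_valuation \<sigma> lam" and ?\<gamma> = "valuation \<sigma> lam p"
  have t01: "t \<in> {0..<1}" using t cd by auto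
  have "(?\<gamma> has_real_derivative - lam * p t * h \<sigma> t * ?\<gamma> t) (at_right t)"
    using valuation_is_valuation[OF p, of \<sigma> lam] t01 by (auto simp: is_valuation_def)
  from DERIV_cmult[OF this, of \<kappa>]
  have "((\<lambda>t. \<kappa> * ?\<gamma> t) has_real_derivative - lam * p t * h \<sigma> t * ?\<gamma>1 t) (at_right t)"
    using eq[OF t] by (simp add: algebra_simps)
  moreover have *: "at_right t = at t within {t..<d}"
    using t by (intro at_within_nhd[of _ "{..<d}"]) auto
  ultimately have "(?\<gamma>1 has_real_derivative - lam * p t * h \<sigma> t * ?\<gamma>1 t) (at t within {t..<d})"
    using t by (auto intro: has_field_derivative_transform_within[OF _ zero_less_one] simp: eq t)
  moreover have "(?\<gamma>1 has_real_derivative - lam * 1 * h \<sigma> t * ?\<gamma>1 t) (at_right t)"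
    using is_valuation_sparing[of \<sigma> lam] t01 by (auto simp: is_valuation_def)
  ultimately have "- lam * p t * h \<sigma> t * ?\<gamma>1 t = - lam * 1 * h \<sigma> t * ?\<gamma>1 t"
    by (intro has_field_derivative_unique[of ?\<gamma>1 _ t "{t<..}"]) (auto simp flip: *)
  moreover have "h \<sigma> t > 0" "?\<gamma>1 t > 0"
    using t01 assms(1) by (auto simp: sparing_valuation_def intro: h_pos)
  ultimately show ?thesis using assms(2) by simp
qed

theorem theorem1:
  fixes \<sigma> lam \<alpha> \<beta> :: real and \<pi> :: "real \<Rightarrow> real"
  assumes "0 < \<sigma>" and "0 < lam" and "0 < \<alpha>" and "\<alpha> < \<beta>"
    and "optimal_control \<sigma> lam \<alpha> \<beta> \<pi>"
  shows "\<not> (\<exists>I. is_interval I \<and> (\<exists>a\<in>I. \<exists>b\<in>I. a < b) \<and> I \<subseteq> {0..1} \<and>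
              (\<forall>t\<in>I. \<pi> t \<in> {0<..<1}))"
proof
  assume "\<exists>I. is_interval I \<and> (\<exists>a\<in>I. \<exists>b\<in>I. a < b) \<and> I \<subseteq> {0..1} \<and> (\<forall>t\<in>I. \<pi> t \<in> {0<..<1})"
  then obtain I a b where I: "is_interval I" "a \<in> I" "b \<in> I" "a < b" "I \<subseteq> {0..1}"
    and mix: "\<And>t. t \<in> I \<Longrightarrow> \<pi> t \<in> {0<..<1}" by blast
  have sub: "{a..b} \<subseteq> I"
    using I(1-3) unfolding is_interval_1 by (meson atLeastAtMost_iff subsetI)
  have ab: "0 \<le> a" "b \<le> 1" using subsetD[OF I(5) I(2)] subsetD[OF I(5) I(3)] by auto
  have mixing: "\<pi> t \<in> {0<..<1}" if "t \<in> {a..b}" for t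
    using mix sub that by blast
  have \<pi>: "control \<pi>" using assms(5) by (simp add: optimal_control_def)
  let ?D = "\<lambda>t. sparing_valuation \<sigma> lam t - (1 - \<alpha> / \<beta>) * valuation \<sigma> lam \<pi> t"
  have stat: "\<psi> \<sigma> lam t = 0 \<or> ?D t = 0" if "t \<in> {a<..<b}" for t
    using optimal_stationary[OF assms, of t] mixing[of t] that ab by auto
  \<comment> \<open>Strict monotonicity allows at most one zero of \<open>\<psi>\<close>;
    \<open>c\<close> is that zero if it lies inside the interval, and \<open>a\<close>
    otherwise.\<close>
  obtain c where c: "c \<in> {a..<b}" "\<And>t. t \<in> {c<..<b} \<Longrightarrow> \<psi> \<sigma> lam t \<noteq> 0"
  proof (cases "\<exists>u\<in>{a<..<b}. \<psi> \<sigma> lam u = 0")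
    case True
    then obtain u where u: "u \<in> {a<..<b}" "\<psi> \<sigma> lam u = 0" by blast
    show ?thesis
    proof (rule that[of u])
      show "\<psi> \<sigma> lam t \<noteq> 0" if "t \<in> {u<..<b}" for t
        using \<psi>_strict_antimono[OF assms(1,2), of u t] u that ab by auto
    qed (use u in auto)
  qed (use that[of a] I in auto)
  have "\<pi> ((c + b) / 2) = 1"
  proof (rule control_one_of_proportional[OF assms(1,2) \<pi>])
    show "sparing_valuation \<sigma> lam t = (1 - \<alpha> / \<beta>) * valuation \<sigma> lam \<pi> t" if "t \<in> {c<..<b}" for t
      using stat[of t] c that by auto
  qed (use c ab in auto)
  thus False using mixing[of "(c + b) / 2"] c by auto
qed

end
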